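(* Let $n$ and $k$ be positive integers with $1 \le k \le n-1$, and write $n = dk + r$ with integers $d, r$ satisfying $0 \leq r < k$. Let $M_{n,k}$ denote the multinomial coefficient $$M_{n,k} = \binom{n}{(d+1)^r, d^{k-r}} = \frac{n!}{((d+1)!)^r\,(d!)^{k-r}},$$ where $i^j$ in the lower entries indicates $i$ repeated $j$ times. Then $$\sum_{\sigma \in \mathfrak{S}_n} q^{\mathrm{des}_k(\sigma)} = M_{n,k}\,\bigl(A_{d+1}(q)\bigr)^r \bigl(A_d(q)\bigr)^{k-r}$$ and $$\sum_{\sigma \in \mathfrak{S}_n} q^{\mathrm{inv}_k(\sigma)} = M_{n,k}\,\bigl([d+1]_q!\bigr)^r \bigl([d]_q!\bigr)^{k-r}.$$
   Context: $\mathfrak{S}_n$ is the set of permutations $\sigma = a_1a_2\cdots a_n$ of $[n]=\{1,\dots,n\}$ in one-line notation. For $1\le k\le n-1$: - $\mathrm{des}_k(\sigma) = |\{i \in [n-k] : a_i > a_{i+k}\}|$ (number of width-$k$ descents); - $\mathrm{inv}_k(\sigma) = |\{(i,j) \in [n]^2 : a_i > a_j \text{ and } j-i = mk \text{ for some positive integer } m\}|$ (number of width-$k$ inversions). $A_m(q)$ is the $m$-th Eulerian polynomial, defined by $\sum_{j\ge 0}(1+j)^m q^j = A_m(q)/(1-q)^{m+1}$ (equivalently, for $m\ge1$, $A_m(q)=\sum_{\sigma\in\mathfrak{S}_m} q^{\mathrm{des}(\sigma)}$ with $\mathrm{des}=\mathrm{des}_1$ the usual number of descents). Also $[m]_q!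 = \prod_{i=1}^m (1+q+\cdots+q^{i-1})$. *)

theory Defs
  imports
    "HOL-Combinatorics.Permutations"
    "HOL-Computational_Algebra.Polynomial_FPS"
begin

text \<open>
  Polynomials in the indeterminate \<open>q\<close> are elements of \<^typ>\<open>rat poly\<close>; \<open>q\<^sup>j\<close> is
  \<open>monom 1 j\<close>. A permutation \<open>a\<^sub>1 \<dots> a\<^sub>n\<close> of \<open>[n]\<close> is a function \<open>\<sigma>\<close> with \<open>\<sigma> permutes {1..n}\<close>
  and \<open>\<sigma> i = a\<^sub>i\<close>.
\<close>

definition width_des :: "nat \<Rightarrow> nat \<Rightarrow> (nat \<Rightarrow> nat) \<Rightarrow> nat" where
  "width_des n k \<sigma> = card {i \<in> {1..n - k}. \<sigma> i > \<sigma> (i + k)}"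

text \<open>\<open>j - i = m k\<close> is written additively because subtraction on \<^typ>\<open>nat\<close> truncates.\<close>

definition width_inv :: "nat \<Rightarrow> nat \<Rightarrow> (nat \<Rightarrow> nat) \<Rightarrow> nat" where
  "width_inv n k \<sigma> =
     card {(i, j) \<in> {1..n} \<times> {1..n}. \<sigma> i > \<sigma> j \<and> (\<exists>m>0. j = i + m * k)}"

text \<open>
  The Eulerian polynomial \<open>A\<^sub>m\<close> is determined by
  \<open>\<Sum>j\<ge>0. (1 + j)\<^sup>m q\<^sup>j = A\<^sub>m(q) / (1 - q)\<^bsup>m+1\<^esup>\<close>, an identity of formal power series. In this
  normalisation \<open>A\<^sub>m(0) = 1\<close>, without the extra factor \<open>q\<close> that some authors include.
\<close>

definition eulerian_poly :: "nat \<Rightarrow> rat poly" where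
  "eulerian_poly m =
     (THE p. Abs_fps (\<lambda>j. of_nat (1 + j) ^ m) = fps_of_poly p / (1 - fps_X) ^ (m + 1))"

lemma eulerian_gf_iff:
  fixes F :: "rat fps"
  shows "F = fps_of_poly p / (1 - fps_X) ^ k \<longleftrightarrow> F * (1 - fps_X) ^ k = fps_of_poly p"
proof -
  have u: "fps_nth ((1 - fps_X) ^ k :: rat fps) 0 \<noteq> 0"
    by (simp add: fps_power_zeroth)
  then have nz: "((1 - fps_X) ^ k :: rat fps) \<noteq> 0"
    by (metis fps_zero_nth)
  show ?thesis
  proof
    assume "F = fps_of_poly p / (1 - fps_X) ^ k"
    then have "F = fps_of_poly p * inverse ((1 - fps_X) ^ k)"
      using u by (simp add: fps_divide_unit)
    then show "F * (1 - fps_X) ^ k = fps_of_poly p"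
      using inverse_mult_eq_1[OF u] by (simp add: mult.assoc)
  next
    assume "F * (1 - fps_X) ^ k = fps_of_poly p"
    then show "F = fps_of_poly p / (1 - fps_X) ^ k"
      using nz by (metis nonzero_mult_div_cancel_right)
  qed
qed

lemma eulerian_poly_ex:
  "\<exists>p. Abs_fps (\<lambda>j. of_nat (1 + j) ^ m) * (1 - fps_X) ^ (m + 1) = (fps_of_poly p :: rat fps)"
proof (induction m)
  case 0
  have "Abs_fps (\<lambda>j. 1) * (1 - fps_X) = (1 :: rat fps)"
    by (rule fps_ext) (auto simp: algebra_simps)
  then show ?case
    by (intro exI[of _ 1]) simp
next
  case (Suc m)
  define F :: "rat fps" where "F = Abs_fps (\<lambda>j. of_nat (1 + j) ^ m)"
  from Suc obtain p where p: "F * (1 - fps_X) ^ (m + 1) = fps_of_poly p"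
    by (auto simp: F_def)
  have F': "Abs_fps (\<lambda>j. of_nat (1 + j) ^ Suc m) = fps_deriv (fps_X * F)"
    by (rule fps_ext) (simp add: F_def algebra_simps)
  have "fps_deriv ((fps_X * F) * (1 - fps_X) ^ (m + 1)) = fps_deriv (fps_X * fps_of_poly p)"
    using p by (simp add: mult.assoc)
  moreover have "fps_deriv ((fps_X * F) * (1 - fps_X) ^ (m + 1)) =
      fps_deriv (fps_X * F) * (1 - fps_X) ^ (m + 1)
      - of_nat (m + 1) * (fps_X * F) * (1 - fps_X) ^ m"
  proof -
    have "fps_deriv ((1 - fps_X) ^ (m + 1)) = (- of_nat (m + 1) * (1 - fps_X) ^ m :: rat fps)"
      by (simp add: fps_deriv_power' del: of_nat_Suc power_Suc)
    then show ?thesis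
      unfolding fps_deriv_mult[of "fps_X * F"] by (simp add: mult_ac del: of_nat_Suc power_Suc)
  qed
  ultimately have "fps_deriv (fps_X * F) * (1 - fps_X) ^ (m + 1)
      = fps_deriv (fps_X * fps_of_poly p) + of_nat (m + 1) * (fps_X * F) * (1 - fps_X) ^ m"
    by (simp add: algebra_simps)
  then have "fps_deriv (fps_X * F) * (1 - fps_X) ^ (m + 1) * (1 - fps_X)
      = (fps_deriv (fps_X * fps_of_poly p) + of_nat (m + 1) * (fps_X * F) * (1 - fps_X) ^ m)
        * (1 - fps_X)"
    by (rule arg_cong)
  also have "\<dots> = fps_deriv (fps_X * fps_of_poly p) * (1 - fps_X)
        + of_nat (m + 1) * fps_X * (F * (1 - fps_X) ^ (m + 1))"
    by (simp only: distrib_left distrib_right mult_ac power_add power_one_right)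
  also have "\<dots> = fps_of_poly (pderiv ([:0, 1:] * p) * [:1, -1:] + of_nat (m + 1) * [:0, 1:] * p)"
  proof -
    have 1: "fps_of_poly [:0, 1:] = (fps_X :: rat fps)"
      by (simp add: fps_of_poly_pCons)
    have 2: "fps_of_poly [:1, -1:] = (1 - fps_X :: rat fps)"
      by (simp add: fps_of_poly_pCons)
    have 3: "fps_of_poly (of_nat (m + 1)) = (of_nat (m + 1) :: rat fps)"
      by (metis fps_of_nat fps_of_poly_const of_nat_poly)
    show ?thesis
      unfolding p fps_of_poly_add fps_of_poly_mult 1 2 3 fps_of_poly_pderiv by (simp add: mult.assoc)
  qed
  finally show ?case
    unfolding F' by (auto simp: mult_ac)
qed

lemma eulerian_poly_gf:
  "Abs_fps (\<lambda>j. of_nat (1 + j) ^ m) = fps_of_poly (eulerian_poly m) / (1 - fps_X) ^ (m + 1)"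
  unfolding eulerian_poly_def
proof (rule theI')
  show "\<exists>!p. Abs_fps (\<lambda>j. of_nat (1 + j) ^ m) = (fps_of_poly p / (1 - fps_X) ^ (m + 1) :: rat fps)"
    unfolding eulerian_gf_iff using eulerian_poly_ex[of m] by (metis fps_of_poly_eq_iff)
qed

definition q_fact :: "nat \<Rightarrow> rat poly" where
  "q_fact m = (\<Prod>i = 1..m. \<Sum>j<i. monom 1 j)"

text \<open>Meaningful when the entries of the list add up to \<open>n\<close>.\<close>

definition multinomial :: "nat \<Rightarrow> nat list \<Rightarrow> rat" where
  "multinomial n ds = fact n / (\<Prod>d\<leftarrow>ds. fact d)"

lemma multinomial_replicate:
  "multinomial n (replicate r (d + 1) @ replicate s d) = fact n / (fact (d + 1) ^ r * fact d ^ s)"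
  by (simp add: multinomial_def prod_list_replicate del: fact_Suc)

end

theory Submission
  imports Defs "HOL-Combinatorics.Multiset_Permutations"
begin

text \<open>
  Read the positions \<open>1, \<dots>, n\<close> residue class by residue class modulo \<open>k\<close>: a permutation becomes a
  word cut into \<open>r\<close> blocks of length \<open>d + 1\<close> and \<open>k - r\<close> blocks of length \<open>d\<close>, and the width-\<open>k\<close>
  statistics are the sums over the blocks of the ordinary statistics. The multinomial coefficient
  counts the ways to distribute the values among the blocks, and each block contributes the
  generating function of the words on a fixed set of values. For inversions this is found by
  conditioning on the first letter, for descents by inserting the largest letter, which yields the
  recurrence that the power series defining \<open>A\<^sub>m\<close> satisfies.
\<close>

section \<open>Words\<close>

text \<open>The block lengths are prescribed in advance, so that one cutting pattern serves all
  words on a given set of values.\<close>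

fun chunks :: "nat list \<Rightarrow> 'a list \<Rightarrow> 'a list list" where
  "chunks [] xs = []"
| "chunks (m # ms) xs = take m xs # chunks ms (drop m xs)"

lemma chunks_concat: "chunks (map length xss) (concat xss) = xss"
  by (induction xss) auto

text \<open>A word on \<open>V\<close> amounts to the choice of the set \<open>S\<close> of its
  first \<open>m\<close> letters, an arrangement of \<open>S\<close> and an arrangement of
  \<open>V - S\<close>; concatenation inverts this decomposition.\<close>

lemma sum_permutations_of_set_split:
  fixes f :: "'a list \<Rightarrow> 'a list \<Rightarrow> 'b :: comm_monoid_add"
  assumes "finite V" "m \<le> card V"
  shows "(\<Sum>xs\<in>permutations_of_set V. f (take m xs) (drop m xs)) =
    (\<Sum>S | S \<subseteq> V \<and> card S = m. \<Sum>ys\<in>permutations_of_set S. \<Sum>zs\<in>permutations_of_set (V - S). f ys zs)"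
proof -
  let ?T = "SIGMA S:{S. S \<subseteq> V \<and> card S = m}. permutations_of_set S \<times> permutations_of_set (V - S)"
  have "(\<Sum>xs\<in>permutations_of_set V. f (take m xs) (drop m xs)) = (\<Sum>(S, ys, zs)\<in>?T. f ys zs)"
  proof (rule sum.reindex_bij_witness[where i = "\<lambda>(S, ys, zs). ys @ zs"
        and j = "\<lambda>xs. (set (take m xs), take m xs, drop m xs)"])
    fix xs assume xs: "xs \<in> permutations_of_set V"
    then have d: "distinct xs" and s: "set xs = V" by (auto simp: permutations_of_set_def)
    have l: "length xs = card V" using d s distinct_card by fastforce
    have "set (take m xs) \<union> set (drop m xs) = V"
      using s by (metis append_take_drop_id set_append)
    moreover have "set (take m xs) \<inter> set (drop m xs) = {}"
      using d by (simp add: set_take_disj_set_drop_if_distinct)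
    ultimately show "(set (take m xs), take m xs, drop m xs) \<in> ?T"
      using d assms l by (auto simp: permutations_of_set_def distinct_card)
  next
    fix t assume t: "t \<in> ?T"
    then obtain S ys zs where t_eq: "t = (S, ys, zs)" and S: "S \<subseteq> V" "card S = m"
      and ys: "set ys = S" "distinct ys" and zs: "set zs = V - S" "distinct zs"
      by (auto simp: permutations_of_set_def)
    have "length ys = m" using ys S by (metis distinct_card)
    with t_eq ys zs S show "(case t of (S, ys, zs) \<Rightarrow> ys @ zs) \<in> permutations_of_set V"
      "(\<lambda>xs. (set (take m xs), take m xs, drop m xs)) (case t of (S, ys, zs) \<Rightarrow> ys @ zs) = t"
      by (auto simp: permutations_of_set_def)
  qed auto
  also have "\<dots> = (\<Sum>S | S \<subseteq> V \<and> card S = m.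
      \<Sum>(ys, zs)\<in>permutations_of_set S \<times> permutations_of_set (V - S). f ys zs)"
    using assms by (subst sum.Sigma) (auto intro: finite_subset)
  finally show ?thesis
    by (simp only: sum.cartesian_product)
qed

text \<open>Induction on the block lengths, splitting off the first block. By the hypothesis on
  \<open>E\<close> a block's total weight depends only on how many values it holds, so all choices
  of its value set contribute equally and only their number, a binomial coefficient,
  remains.\<close>

lemma sum_permutations_of_set_chunks:
  fixes w :: "'a list \<Rightarrow> rat poly"
  assumes E: "\<And>S. finite S \<Longrightarrow> (\<Sum>xs\<in>permutations_of_set S. w xs) = E (card S)"
  assumes "finite V" "card V = sum_list ms"
  shows "(\<Sum>xs\<in>permutations_of_set V. \<Prod>b\<leftarrow>chunks ms xs. w b) =
    smult (multinomial (card V) ms) (\<Prod>m\<leftarrow>ms. E m)"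
  using assms(2,3)
proof (induction ms arbitrary: V)
  case Nil
  then show ?case by (simp add: multinomial_def)
next
  case (Cons m ms)
  let ?n = "card V"
  have m: "m \<le> ?n" using Cons.prems by simp
  have "(\<Sum>xs\<in>permutations_of_set V. \<Prod>b\<leftarrow>chunks (m # ms) xs. w b) =
      (\<Sum>S | S \<subseteq> V \<and> card S = m. (\<Sum>ys\<in>permutations_of_set S. w ys) *
         (\<Sum>zs\<in>permutations_of_set (V - S). \<Prod>b\<leftarrow>chunks ms zs. w b))"
    using sum_permutations_of_set_split[OF Cons.prems(1) m,
        of "\<lambda>ys zs. w ys * (\<Prod>b\<leftarrow>chunks ms zs. w b)"]
    by (simp add: sum_product)
  also have "\<dots> = (\<Sum>S | S \<subseteq> V \<and> card S = m.
      E m * smult (multinomial (?n - m) ms) (\<Prod>m\<leftarrow>ms. E m))"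
  proof (rule sum.cong[OF refl])
    fix S assume "S \<in> {S. S \<subseteq> V \<and> card S = m}"
    then have S: "finite S" "S \<subseteq> V" "card S = m" using Cons.prems finite_subset by auto
    then have "card (V - S) = ?n - m" by (simp add: card_Diff_subset)
    moreover have "?n - m = sum_list ms" using Cons.prems by simp
    ultimately show "(\<Sum>ys\<in>permutations_of_set S. w ys) *
         (\<Sum>zs\<in>permutations_of_set (V - S). \<Prod>b\<leftarrow>chunks ms zs. w b) =
         E m * smult (multinomial (?n - m) ms) (\<Prod>m\<leftarrow>ms. E m)"
      using Cons.IH[of "V - S"] Cons.prems E[of S] S by simp
  qed
  also have "\<dots> = smult (of_nat (?n choose m) * multinomial (?n - m) ms) (\<Prod>m\<leftarrow>m # ms. E m)"
    using n_subsets[OF Cons.prems(1), of m] by (simp add: of_nat_poly mult.commute)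
  \<comment> \<open>The factor \<open>fact (?n - m)\<close> cancels, so the binomial coefficients
    accumulate to the multinomial coefficient.\<close>
  also have "of_nat (?n choose m) * multinomial (?n - m) ms = multinomial ?n (m # ms)"
    using m by (simp add: multinomial_def binomial_fact)
  finally show ?case .
qed

text \<open>The order of \<open>ps\<close> is arbitrary, which permits reading the positions class
  by class. The map is injective because permutations of \<open>A\<close> fix everything outside
  \<open>A\<close>; it is onto because both sides have the same finite cardinality.\<close>

lemma bij_betw_permutes_permutations_of_set:
  assumes "distinct ps" "set ps = A"
  shows "bij_betw (\<lambda>\<sigma>. map \<sigma> ps) {\<sigma>. \<sigma> permutes A} (permutations_of_set A)"
proof -
  have fin: "finite A" using assms by auto
  have "inj_on (\<lambda>\<sigma>. map \<sigma> ps) {\<sigma>. \<sigma> permutes A}"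
  proof (rule inj_onI)
    fix \<sigma> \<tau> assume *: "\<sigma> \<in> {\<sigma>. \<sigma> permutes A}" "\<tau> \<in> {\<sigma>. \<sigma> permutes A}" "map \<sigma> ps = map \<tau> ps"
    then have "\<forall>x\<in>A. \<sigma> x = \<tau> x"
      using assms by simp
    moreover have "\<sigma> x = \<tau> x" if "x \<notin> A" for x
      using * that by (simp add: permutes_not_in)
    ultimately show "\<sigma> = \<tau>"
      by blast
  qed
  moreover have "(\<lambda>\<sigma>. map \<sigma> ps) ` {\<sigma>. \<sigma> permutes A} \<subseteq> permutations_of_set A"
  proof
    fix xs assume "xs \<in> (\<lambda>\<sigma>. map \<sigma> ps) ` {\<sigma>. \<sigma> permutes A}"
    then obtain \<sigma> where "xs = map \<sigma> ps" "\<sigma> permutes A" by blast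
    then show "xs \<in> permutations_of_set A"
      using assms permutes_image[of \<sigma> A] permutes_inj_on[of \<sigma> A A]
      by (simp add: permutations_of_set_def distinct_map)
  qed
  moreover have "card {\<sigma>. \<sigma> permutes A} = card (permutations_of_set A)"
    using fin by (simp add: card_permutations)
  ultimately show ?thesis
    using fin by (simp add: bij_betw_def card_image card_subset_eq)
qed

section \<open>Inversions\<close>

definition list_inv :: "'a :: linorder list \<Rightarrow> nat" where
  "list_inv xs = card {(i, j). i < j \<and> j < length xs \<and> xs ! i > xs ! j}"

lemma list_inv_Nil [simp]: "list_inv [] = 0"
  by (simp add: list_inv_def)

text \<open>The inversions involving position 0 form \<open>A\<close>, the others are those of
  \<open>xs\<close> shifted by one and form \<open>B\<close>. Distinctness allows counting smaller
  letters as values instead of positions.\<close>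

lemma list_inv_Cons:
  assumes "distinct xs"
  shows "list_inv (x # xs) = card {y \<in> set xs. y < x} + list_inv xs"
proof -
  define J where "J = {j. j < length xs \<and> xs ! j < x}"
  define I where "I = {(i, j). i < j \<and> j < length xs \<and> xs ! i > xs ! j}"
  define A where "A = Pair (0 :: nat) ` Suc ` J"
  define B where "B = map_prod Suc Suc ` I"
  have fin: "finite I" "finite J"
    by (rule finite_subset[of _ "{..<length xs} \<times> {..<length xs}"] finite_subset[of _ "{..<length xs}"],
        force simp: I_def J_def, simp)+
  have "p \<in> A \<union> B \<longleftrightarrow> fst p < snd p \<and> snd p < length (x # xs) \<and> (x # xs) ! fst p > (x # xs) ! snd p"
    for p
  proof (cases p)
    case (Pair i j)
    have "(0, Suc j') \<in> A \<longleftrightarrow> j' \<in> J" "(Suc i', j) \<notin> A" "(0, j) \<notin> B"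
      "(Suc i', Suc j') \<in> B \<longleftrightarrow> (i', j') \<in> I" "(i, 0) \<notin> A" "(i, 0) \<notin> B" for i' j'
      unfolding A_def B_def by (auto simp: image_iff intro: bexI[rotated])
    then show ?thesis
      unfolding Pair by (cases i; cases j) (simp_all add: I_def J_def)
  qed
  then have "{(i, j). i < j \<and> j < length (x # xs) \<and> (x # xs) ! i > (x # xs) ! j} = A \<union> B"
    by (intro set_eqI) (simp add: case_prod_beta)
  then have "list_inv (x # xs) = card (A \<union> B)"
    unfolding list_inv_def by (rule arg_cong)
  also have "\<dots> = card A + card B"
  proof (rule card_Un_disjoint)
    show "finite A" "finite B" using fin by (simp_all add: A_def B_def)
    show "A \<inter> B = {}" unfolding A_def B_def by auto
  qed
  also have "card B = list_inv xs"
    unfolding B_def I_def list_inv_def by (rule card_image) (auto simp: inj_on_def)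
  also have "card A = card J"
    unfolding A_def by (simp add: card_image inj_on_def)
  also have "\<dots> = length (filter (\<lambda>y. y < x) xs)"
    by (simp add: J_def length_filter_conv_card)
  also have "\<dots> = card {y \<in> set xs. y < x}"
    using distinct_card[of "filter (\<lambda>y. y < x) xs"] assms by simp
  finally show ?thesis .
qed

text \<open>The exponent is the rank of \<open>x\<close> in \<open>S\<close>, which takes each value
  below \<open>card S\<close> exactly once. Adding a new maximum \<open>b\<close> to
  \<open>A\<close> creates the rank \<open>card A\<close> and leaves the other ranks alone.\<close>

lemma sum_power_rank:
  fixes q :: "'b :: comm_semiring_1" and S :: "'a :: linorder set"
  assumes "finite S"
  shows "(\<Sum>x\<in>S. q ^ card {y \<in> S. y < x}) = (\<Sum>j<card S. q ^ j)"
  using assms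
proof (induction rule: finite_linorder_max_induct)
  case empty
  then show ?case by simp
next
  case (insert b A)
  have "{y \<in> insert b A. y < b} = A" "b \<notin> A" using insert by auto
  moreover have "{y \<in> insert b A. y < x} = {y \<in> A. y < x}" if "x \<in> A" for x
    using insert that by auto
  ultimately show ?case
    using insert by (simp add: add.commute)
qed

text \<open>A first letter \<open>x\<close> is in inversion with exactly the smaller elements of
  \<open>S\<close>. The rest is a word on \<open>S - {x}\<close>, whose sum does not depend on
  \<open>x\<close>, so summing over the rank of \<open>x\<close> yields one more factor of the
  product.\<close>

lemma sum_power_list_inv:
  fixes q :: "'b :: comm_semiring_1" and S :: "'a :: linorder set"
  assumes "finite S"
  shows "(\<Sum>xs\<in>permutations_of_set S. q ^ list_inv xs) = (\<Prod>i = 1..card S. \<Sum>j<i. q ^ j)"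
  using assms
proof (induction "card S" arbitrary: S)
  case 0
  then show ?case by simp
next
  case (Suc m)
  then have ne: "S \<noteq> {}" by auto
  have "(\<Sum>xs\<in>permutations_of_set S. q ^ list_inv xs) =
      (\<Sum>x\<in>S. \<Sum>xs\<in>(#) x ` permutations_of_set (S - {x}). q ^ list_inv xs)"
    unfolding permutations_of_set_nonempty[OF ne]
    using Suc.prems by (intro sum.UNION_disjoint) auto
  also have "\<dots> = (\<Sum>x\<in>S. \<Sum>xs\<in>permutations_of_set (S - {x}). q ^ list_inv (x # xs))"
    by (simp add: sum.reindex)
  also have "\<dots> = (\<Sum>x\<in>S. q ^ card {y \<in> S. y < x} * (\<Prod>i = 1..m. \<Sum>j<i. q ^ j))"
  proof (rule sum.cong[OF refl])
    fix x assume x: "x \<in> S"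
    have "{y \<in> S - {x}. y < x} = {y \<in> S. y < x}" by auto
    then have "list_inv (x # xs) = card {y \<in> S. y < x} + list_inv xs"
      if "xs \<in> permutations_of_set (S - {x})" for xs
      using list_inv_Cons[of xs x] that by (simp add: permutations_of_set_def)
    then have "(\<Sum>xs\<in>permutations_of_set (S - {x}). q ^ list_inv (x # xs)) =
        q ^ card {y \<in> S. y < x} * (\<Sum>xs\<in>permutations_of_set (S - {x}). q ^ list_inv xs)"
      by (simp add: power_add sum_distrib_left)
    also have "(\<Sum>xs\<in>permutations_of_set (S - {x}). q ^ list_inv xs) = (\<Prod>i = 1..m. \<Sum>j<i. q ^ j)"
    proof -
      have "card (S - {x}) = m" using Suc x by simp
      then show ?thesis using Suc.hyps(1)[of "S - {x}"] Suc.prems by simp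
    qed
    finally show "(\<Sum>xs\<in>permutations_of_set (S - {x}). q ^ list_inv (x # xs)) =
        q ^ card {y \<in> S. y < x} * (\<Prod>i = 1..m. \<Sum>j<i. q ^ j)" .
  qed
  also have "\<dots> = (\<Prod>i = 1..Suc m. \<Sum>j<i. q ^ j)"
    unfolding sum_distrib_right[symmetric] sum_power_rank[OF Suc.prems] Suc.hyps(2)[symmetric]
    by (simp add: mult.commute)
  finally show ?case
    by (simp add: Suc.hyps(2))
qed

section \<open>Descents\<close>

definition list_des :: "'a :: linorder list \<Rightarrow> nat" where
  "list_des xs = card {i. Suc i < length xs \<and> xs ! i > xs ! Suc i}"

lemma list_des_Nil [simp]: "list_des [] = 0"
  and list_des_single [simp]: "list_des [x] = 0"
  by (simp_all add: list_des_def)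

lemma list_des_Cons_Cons [simp]:
  "list_des (x # y # zs) = (if x > y then 1 else 0) + list_des (y # zs)"
proof -
  let ?D = "\<lambda>xs :: 'a list. {i. Suc i < length xs \<and> xs ! i > xs ! Suc i}"
  have fin: "finite (?D (y # zs))"
    by (rule finite_subset[of _ "{..<length (y # zs)}"]) auto
  have *: "?D (x # y # zs) = (if x > y then {0} else {}) \<union> Suc ` ?D (y # zs)"
  proof (intro set_eqI)
    fix i show "i \<in> ?D (x # y # zs) \<longleftrightarrow> i \<in> (if x > y then {0} else {}) \<union> Suc ` ?D (y # zs)"
      by (cases i) auto
  qed
  show ?thesis
    unfolding list_des_def * using fin by (subst card_Un_disjoint) (auto simp: card_image)
qed

text \<open>Placing the new maximum inside a descent or at the end preserves the number of descents;
  any other slot raises it by one. The number of the latter slots is a difference taken in the ring,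
  where subtraction does not truncate.\<close>

lemma sum_list_des_insert_max:
  fixes q :: "'b :: comm_ring_1" and x :: "'a :: linorder"
  assumes "\<forall>y\<in>set ys. y < x"
  shows "(\<Sum>i\<le>length ys. q ^ list_des (take i ys @ x # drop i ys)) =
    (1 + of_nat (list_des ys)) * q ^ list_des ys
      + (of_nat (length ys) - of_nat (list_des ys)) * q ^ Suc (list_des ys)"
  using assms
proof (induction ys rule: induct_list012)
  case 1
  then show ?case by simp
next
  case (2 y)
  then show ?case by auto
next
  case (3 y z zs)
  let ?f = "\<lambda>ys i. q ^ list_des (take i ys @ x # drop i ys)"
  let ?c = "if y > z then q else 1"
  \<comment> \<open>Slots 0 and 1 are treated separately: from slot 2 on, \<open>y\<close> and
    \<open>z\<close> stay adjacent and their pair contributes the constant factor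
    \<open>?c\<close>.\<close>
  have "(\<Sum>i\<le>length (y # z # zs). ?f (y # z # zs) i) =
      ?f (y # z # zs) 0 + (?f (y # z # zs) 1 + (\<Sum>i\<le>length zs. ?f (y # z # zs) (Suc (Suc i))))"
    by (simp add: sum.atMost_Suc_shift del: sum.atMost_Suc)
  also have "(\<Sum>i\<le>length zs. ?f (y # z # zs) (Suc (Suc i))) =
      ?c * (\<Sum>i\<le>length zs. ?f (z # zs) (Suc i))"
    by (simp add: sum_distrib_left)
  \<comment> \<open>Slot 0 of \<open>z # zs\<close> is restored and subtracted again, so that the
    induction hypothesis applies to the full sum.\<close>
  also have "(\<Sum>i\<le>length zs. ?f (z # zs) (Suc i)) =
      (\<Sum>i\<le>length (z # zs). ?f (z # zs) i) - ?f (z # zs) 0"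
    by (simp add: sum.atMost_Suc_shift del: sum.atMost_Suc)
  also have "(\<Sum>i\<le>length (z # zs). ?f (z # zs) i) =
    (1 + of_nat (list_des (z # zs))) * q ^ list_des (z # zs)
      + (of_nat (length (z # zs)) - of_nat (list_des (z # zs))) * q ^ Suc (list_des (z # zs))"
    using 3 by simp
  also have "?f (y # z # zs) 0 = q ^ Suc (list_des (y # z # zs))"
    using 3(3) by simp
  also have "?f (y # z # zs) 1 = q ^ Suc (list_des (z # zs))"
    using 3(3) by auto
  also have "?f (z # zs) 0 = q ^ Suc (list_des (z # zs))"
    using 3(3) by simp
  finally show ?case
    by (cases "y > z") (simp_all add: ring_distribs mult_ac)
qed

text \<open>Deleting \<open>x\<close> recovers the shorter word, and the number of letters before
  \<open>x\<close> recovers the slot.\<close>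

lemma sum_permutations_of_set_insert:
  fixes f :: "'a list \<Rightarrow> 'b :: comm_monoid_add"
  assumes "finite S" "x \<notin> S"
  shows "(\<Sum>xs\<in>permutations_of_set (insert x S). f xs) =
    (\<Sum>ys\<in>permutations_of_set S. \<Sum>i\<le>length ys. f (take i ys @ x # drop i ys))"
proof -
  let ?T = "SIGMA ys:permutations_of_set S. {..length ys}"
  have "(\<Sum>(ys, i)\<in>?T. f (take i ys @ x # drop i ys)) = (\<Sum>xs\<in>permutations_of_set (insert x S). f xs)"
  proof (rule sum.reindex_bij_witness[where j = "\<lambda>(ys, i). take i ys @ x # drop i ys"
        and i = "\<lambda>xs. (remove1 x xs, length (takeWhile (\<lambda>y. y \<noteq> x) xs))"])
    fix t assume "t \<in> ?T"
    then obtain ys i where t: "t = (ys, i)" "set ys = S" "distinct ys" "i \<le> length ys"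
      by (auto simp: permutations_of_set_def)
    have nt: "x \<notin> set (take i ys)" using t assms in_set_takeD by fastforce
    have "set (take i ys) \<union> set (drop i ys) = S"
      using t by (metis append_take_drop_id set_append)
    moreover have "set (take i ys) \<inter> set (drop i ys) = {}"
      using t by (simp add: set_take_disj_set_drop_if_distinct)
    ultimately show "(case t of (ys, i) \<Rightarrow> take i ys @ x # drop i ys) \<in> permutations_of_set (insert x S)"
      using t assms by (auto simp: permutations_of_set_def)
    have "takeWhile (\<lambda>y. y \<noteq> x) (take i ys @ x # drop i ys) = take i ys"
      using nt by (subst takeWhile_append2) auto
    then show "(\<lambda>xs. (remove1 x xs, length (takeWhile (\<lambda>y. y \<noteq> x) xs)))
        (case t of (ys, i) \<Rightarrow> take i ys @ x # drop i ys) = t"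
      using t nt by (simp add: remove1_append)
  next
    fix xs assume "xs \<in> permutations_of_set (insert x S)"
    then have xs: "set xs = insert x S" "distinct xs" by (auto simp: permutations_of_set_def)
    then obtain us vs where eq: "xs = us @ x # vs" by (metis insertI1 split_list)
    have nu: "x \<notin> set us" "x \<notin> set vs" using eq xs by auto
    have r: "remove1 x xs = us @ vs" using eq nu by (simp add: remove1_append)
    have tw: "takeWhile (\<lambda>y. y \<noteq> x) xs = us"
      unfolding eq using nu by (subst takeWhile_append2) auto
    show "(remove1 x xs, length (takeWhile (\<lambda>y. y \<noteq> x) xs)) \<in> ?T"
      unfolding r tw using xs eq nu assms by (auto simp: permutations_of_set_def)
    show "(case (remove1 x xs, length (takeWhile (\<lambda>y. y \<noteq> x) xs)) of
        (ys, i) \<Rightarrow> take i ys @ x # drop i ys) = xs"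
      unfolding r tw using eq by simp
  qed auto
  then show ?thesis
    using assms by (subst sum.Sigma) auto
qed

section \<open>The recurrence of the Eulerian polynomials and its match with descents\<close>

lemma eulerian_poly_0: "eulerian_poly 0 = 1"
proof -
  have "Abs_fps (\<lambda>j. 1) * (1 - fps_X) = (1 :: rat fps)"
    by (rule fps_ext) (auto simp: algebra_simps)
  then have "fps_of_poly (eulerian_poly 0) = 1"
    using eulerian_poly_gf[of 0] unfolding eulerian_gf_iff by simp
  then show ?thesis
    by (metis fps_of_poly_1 fps_of_poly_eq_iff)
qed

text \<open>The defining series satisfy \<open>F (Suc m) = F m + fps_X * fps_deriv (F m)\<close>.
  Multiplying by \<open>u ^ (m + 2)\<close> and applying the product rule to
  \<open>F m * u ^ (m + 1)\<close> turns this into a recurrence for the numerators.\<close>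

lemma eulerian_poly_Suc:
  "eulerian_poly (Suc m) = (1 + of_nat m * monom 1 1) * eulerian_poly m
     + monom 1 1 * (1 - monom 1 1) * pderiv (eulerian_poly m)"
proof -
  define F where "F m = (Abs_fps (\<lambda>j. of_nat (1 + j) ^ m) :: rat fps)" for m
  define u where "u = (1 - fps_X :: rat fps)"
  have P: "fps_of_poly (eulerian_poly m) = F m * u ^ (m + 1)" for m
    using eulerian_poly_gf[of m] unfolding eulerian_gf_iff F_def u_def by simp
  have F_Suc: "F (Suc m) = F m + fps_X * fps_deriv (F m)"
    by (rule fps_ext) (auto simp: F_def algebra_simps fps_deriv_nth)
  have "fps_deriv (u ^ (m + 1)) = - of_nat (m + 1) * u ^ m"
    unfolding u_def by (simp add: fps_deriv_power' del: of_nat_Suc power_Suc)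
  then have P': "fps_of_poly (pderiv (eulerian_poly m)) =
      fps_deriv (F m) * u ^ (m + 1) - of_nat (m + 1) * F m * u ^ m"
    unfolding fps_of_poly_pderiv P fps_deriv_mult[of "F m"] by (simp only:) (simp add: algebra_simps)
  have X: "fps_of_poly (monom 1 1) = (fps_X :: rat fps)"
    by (simp add: fps_of_poly_monom)
  have N: "fps_of_poly (of_nat m) = (of_nat m :: rat fps)"
    by (metis fps_of_nat fps_of_poly_const of_nat_poly)
  have "fps_of_poly (eulerian_poly (Suc m)) = (F m + fps_X * fps_deriv (F m)) * u ^ (m + 2)"
    using P[of "Suc m"] F_Suc by simp
  also have "\<dots> = (1 + of_nat m * fps_X) * (F m * u ^ (m + 1))
     + fps_X * u * (fps_deriv (F m) * u ^ (m + 1) - of_nat (m + 1) * F m * u ^ m)"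
  proof -
    \<comment> \<open>Eliminating \<open>fps_X\<close> leaves a ring identity in \<open>u\<close>,
      \<open>F m\<close> and its derivative.\<close>
    have *: "fps_X = 1 - u" by (simp add: u_def)
    show ?thesis unfolding * by (simp add: algebra_simps)
  qed
  also have "\<dots> = fps_of_poly ((1 + of_nat m * monom 1 1) * eulerian_poly m
     + monom 1 1 * (1 - monom 1 1) * pderiv (eulerian_poly m))"
    unfolding fps_of_poly_add fps_of_poly_mult fps_of_poly_diff fps_of_poly_1 X N P P' u_def ..
  finally show ?thesis
    by (simp only: fps_of_poly_eq_iff)
qed

text \<open>Inserting the largest letter into a word with \<open>e\<close> descents gives
  \<open>(1 + e) q ^ e + (m - e) q ^ (e + 1)\<close>, where \<open>m = card S\<close>. This equals
  \<open>(1 + m q) q ^ e + (1 - q) e q ^ e\<close>, and summing over all words reproduces the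
  Eulerian recurrence.\<close>

lemma sum_monom_list_des:
  fixes S :: "'a :: linorder set"
  assumes "finite S"
  shows "(\<Sum>xs\<in>permutations_of_set S. monom 1 (list_des xs)) = eulerian_poly (card S)"
  using assms
proof (induction rule: finite_linorder_max_induct)
  case empty
  then show ?case by (simp add: eulerian_poly_0)
next
  case (insert x S)
  define q :: "rat poly" where "q = monom 1 1"
  have q: "monom 1 e = q ^ e" for e
    by (simp add: q_def monom_power)
  \<comment> \<open>The operator \<open>q * pderiv\<close> extracts the number of descents as a
    factor, which is how the derivative enters.\<close>
  have dq: "q * pderiv (q ^ e) = of_nat e * q ^ e" for e
    by (cases e) (simp_all add: q_def monom_power pderiv_monom mult_monom of_nat_monom)
  have dsum: "pderiv (\<Sum>ys\<in>T. f ys) = (\<Sum>ys\<in>T. pderiv (f ys))"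
    for f :: "'a list \<Rightarrow> rat poly" and T
    using higher_pderiv_sum[of 1 f T] by simp
  have nin: "x \<notin> S" using insert by auto
  have "(\<Sum>xs\<in>permutations_of_set (insert x S). q ^ list_des xs) =
      (\<Sum>ys\<in>permutations_of_set S. (1 + of_nat (list_des ys)) * q ^ list_des ys
      + (of_nat (length ys) - of_nat (list_des ys)) * q ^ Suc (list_des ys))"
    unfolding sum_permutations_of_set_insert[OF insert.hyps(1) nin]
    using insert.hyps(2)
    by (intro sum.cong refl sum_list_des_insert_max) (auto simp: permutations_of_set_def)
  also have "\<dots> = (\<Sum>ys\<in>permutations_of_set S. (1 + of_nat (card S) * q) * q ^ list_des ys
      + (1 - q) * (q * pderiv (q ^ list_des ys)))"
    unfolding dq
    by (intro sum.cong refl) (auto simp: length_finite_permutations_of_set algebra_simps)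
  also have "\<dots> = (1 + of_nat (card S) * q) * (\<Sum>ys\<in>permutations_of_set S. q ^ list_des ys)
      + q * (1 - q) * pderiv (\<Sum>ys\<in>permutations_of_set S. q ^ list_des ys)"
    by (simp add: sum.distrib sum_distrib_left dsum mult_ac)
  also have "\<dots> = eulerian_poly (Suc (card S))"
    using insert.IH by (simp add: eulerian_poly_Suc q flip: q_def)
  finally show ?case
    using insert.hyps(1) nin by (simp add: q)
qed

section \<open>Residue classes\<close>

locale residue_classes =
  fixes n k d r :: nat
  assumes n_eq: "n = d * k + r" and r_less: "r < k"
begin

definition class_size :: "nat \<Rightarrow> nat" where
  "class_size c = (if c < r then d + 1 else d)"

text \<open>Classes \<open>c\<close> and indices \<open>j\<close> count from 0 while positions count
  from 1, hence the \<open>Suc\<close>: class \<open>c\<close> holds the positions congruent to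
  \<open>c + 1\<close> modulo \<open>k\<close>.\<close>

definition pos :: "nat \<Rightarrow> nat \<Rightarrow> nat" where
  "pos c j = Suc (c + j * k)"

definition classes :: "nat list list" where
  "classes = map (\<lambda>c. map (pos c) [0..<class_size c]) [0..<k]"

lemma pos_eq_iff:
  assumes "c < k" "c' < k"
  shows "pos c j = pos c' j' \<longleftrightarrow> c = c' \<and> j = j'"
proof
  assume "pos c j = pos c' j'"
  then have *: "c + j * k = c' + j' * k" by (simp add: pos_def)
  then have "(c + j * k) mod k = (c' + j' * k) mod k" "(c + j * k) div k = (c' + j' * k) div k"
    by simp_all
  then show "c = c' \<and> j = j'" using assms by simp
qed simp

lemma pos_cases:
  assumes "1 \<le> i"
  obtains c j where "c < k" "i = pos c j"
proof
  show "(i - 1) mod k < k" using r_less by simp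
  show "i = pos ((i - 1) mod k) ((i - 1) div k)" using assms by (simp add: pos_def)
qed

text \<open>Arrange the positions in rows of length \<open>k\<close>. Rows \<open>j < d\<close> are
  full, row \<open>d\<close> contains only the classes \<open>c < r\<close>, and later rows lie
  beyond \<open>n\<close>.\<close>

lemma pos_le_iff:
  assumes "c < k"
  shows "pos c j \<le> n \<longleftrightarrow> j < class_size c"
proof -
  consider "j < d" | "j = d" | "d < j" by linarith
  then show ?thesis
  proof cases
    case 1
    then have "Suc j * k \<le> d * k" by (intro mult_right_mono) auto
    with 1 assms show ?thesis by (simp add: pos_def class_size_def n_eq)
  next
    case 2
    then show ?thesis by (auto simp: pos_def class_size_def n_eq)
  next
    case 3
    then have "Suc d * k \<le> j * k" by (intro mult_right_mono) auto
    with 3 r_less show ?thesis by (simp add: pos_def class_size_def n_eq)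
  qed
qed

lemma pos_add: "pos c j + m * k = pos c (j + m)"
  by (simp add: pos_def algebra_simps)

lemma class_sizes: "map class_size [0..<k] = replicate r (d + 1) @ replicate (k - r) d"
  using r_less by (intro nth_equalityI) (auto simp: class_size_def nth_append)

lemma length_classes: "map length classes = map class_size [0..<k]"
  by (simp add: classes_def)

lemma sum_class_sizes: "sum_list (replicate r (d + 1) @ replicate (k - r) d) = n"
proof -
  have "r * (d + 1) + (k - r) * d = (r + (k - r)) * d + r" by (simp add: algebra_simps)
  then show ?thesis using r_less by (simp add: sum_list_replicate n_eq)
qed

lemma set_concat_classes: "set (concat classes) = {1..n}"
proof (intro equalityI subsetI)
  fix i assume "i \<in> set (concat classes)"
  then obtain c j where "c < k" "j < class_size c" "i = pos c j" by (auto simp: classes_def)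
  then show "i \<in> {1..n}" using pos_le_iff[of c j] by (auto simp: pos_def)
next
  fix i assume i: "i \<in> {1..n}"
  then obtain c j where cj: "c < k" "i = pos c j" using pos_cases[of i] by auto
  then have "j < class_size c" using i pos_le_iff by auto
  then show "i \<in> set (concat classes)" using cj by (fastforce simp: classes_def)
qed

text \<open>By counting: the class sizes add up to \<open>n\<close>, and the entries cover a set of
  \<open>n\<close> elements.\<close>

lemma distinct_concat_classes: "distinct (concat classes)"
proof (rule card_distinct)
  show "card (set (concat classes)) = length (concat classes)"
    using sum_class_sizes
    by (simp only: set_concat_classes length_concat length_classes class_sizes) simp
qed

section \<open>The width-\<open>k\<close> statistics as sums over residue classes\<close>

text \<open>Positions \<open>i\<close> and \<open>i + k\<close> are neighbours in the same class, so
  width-\<open>k\<close> descents are the ordinary descents of the subwords along the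
  classes.\<close>

lemma width_des_eq:
  assumes "k \<le> n"
  shows "width_des n k \<sigma> = (\<Sum>b\<leftarrow>classes. list_des (map \<sigma> b))"
proof -
  let ?D = "\<lambda>c. {j. Suc j < class_size c \<and> \<sigma> (pos c j) > \<sigma> (pos c (Suc j))}"
  have fin: "finite (?D c)" for c
    by (rule finite_subset[of _ "{..<class_size c}"]) auto
  \<comment> \<open>Position \<open>i\<close> is at most \<open>n - k\<close> exactly when its class
    has a next element.\<close>
  have mem: "pos c j \<in> {1..n - k} \<longleftrightarrow> Suc j < class_size c" if "c < k" for c j
    using pos_le_iff[OF that, of "Suc j"] assms pos_add[of c j 1] by (auto simp: pos_def)
  have "bij_betw (\<lambda>(c, j). pos c j) (Sigma {..<k} ?D) {i \<in> {1..n - k}. \<sigma> i > \<sigma> (i + k)}"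
  proof (rule bij_betw_imageI)
    show "inj_on (\<lambda>(c, j). pos c j) (Sigma {..<k} ?D)"
      by (auto simp: inj_on_def pos_eq_iff)
    show "(\<lambda>(c, j). pos c j) ` Sigma {..<k} ?D = {i \<in> {1..n - k}. \<sigma> i > \<sigma> (i + k)}"
    proof (intro equalityI subsetI)
      fix i assume "i \<in> (\<lambda>(c, j). pos c j) ` Sigma {..<k} ?D"
      then obtain c j where "c < k" "j \<in> ?D c" "i = pos c j" by auto
      then show "i \<in> {i \<in> {1..n - k}. \<sigma> i > \<sigma> (i + k)}"
        using mem[of c j] pos_add[of c j 1] by simp
    next
      fix i assume i: "i \<in> {i \<in> {1..n - k}. \<sigma> i > \<sigma> (i + k)}"
      then obtain c j where cj: "c < k" "i = pos c j" using pos_cases[of i] by auto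
      then have "j \<in> ?D c" using i mem[of c j] pos_add[of c j 1] by simp
      then show "i \<in> (\<lambda>(c, j). pos c j) ` Sigma {..<k} ?D" using cj by force
    qed
  qed
  then have "width_des n k \<sigma> = card (Sigma {..<k} ?D)"
    unfolding width_des_def by (rule bij_betw_same_card[symmetric])
  also have "\<dots> = (\<Sum>c<k. card (?D c))"
    using fin by (simp add: card_SigmaI)
  also have "\<dots> = (\<Sum>c<k. list_des (map (\<lambda>j. \<sigma> (pos c j)) [0..<class_size c]))"
    unfolding list_des_def by (intro sum.cong refl arg_cong[where f = card]) auto
  finally show ?thesis
    by (simp add: classes_def comp_def sum_list_distinct_conv_sum_set atLeast0LessThan)
qed

text \<open>Two positions differ by a positive multiple \<open>m * k\<close> exactly when they lie
  in one class, \<open>m\<close> steps apart.\<close>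

lemma width_inv_eq: "width_inv n k \<sigma> = (\<Sum>b\<leftarrow>classes. list_inv (map \<sigma> b))"
proof -
  let ?I = "\<lambda>c. {(i, j). i < j \<and> j < class_size c \<and> \<sigma> (pos c i) > \<sigma> (pos c j)}"
  let ?J = "{(i, j) \<in> {1..n} \<times> {1..n}. \<sigma> i > \<sigma> j \<and> (\<exists>m>0. j = i + m * k)}"
  let ?h = "\<lambda>(c, i, j). (pos c i, pos c j)"
  have fin: "finite (?I c)" for c
    by (rule finite_subset[of _ "{..<class_size c} \<times> {..<class_size c}"]) auto
  have "bij_betw ?h (Sigma {..<k} ?I) ?J"
  proof (rule bij_betw_imageI)
    show "inj_on ?h (Sigma {..<k} ?I)"
      by (auto simp: inj_on_def pos_eq_iff)
    show "?h ` Sigma {..<k} ?I = ?J"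
    proof (intro equalityI subsetI)
      fix p assume "p \<in> ?h ` Sigma {..<k} ?I"
      then obtain c i j where *: "c < k" "i < j" "j < class_size c" "\<sigma> (pos c i) > \<sigma> (pos c j)"
        "p = (pos c i, pos c j)" by auto
      moreover have "pos c i \<in> {1..n}" "pos c j \<in> {1..n}"
        using * pos_le_iff[of c i] pos_le_iff[of c j] by (auto simp: pos_def)
      moreover have "pos c j = pos c i + (j - i) * k" "j - i > 0"
        using * by (simp_all add: pos_add)
      ultimately show "p \<in> ?J" by blast
    next
      fix p assume "p \<in> ?J"
      then obtain x m where *: "p = (x, x + m * k)" "1 \<le> x" "x + m * k \<le> n" "m > 0"
        "\<sigma> x > \<sigma> (x + m * k)" by auto
      then obtain c i where ci: "c < k" "x = pos c i" using pos_cases by blast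
      then have "(c, i, i + m) \<in> Sigma {..<k} ?I"
        using * pos_le_iff[of c "i + m"] by (simp add: pos_add)
      moreover have "p = ?h (c, i, i + m)" using * ci by (simp add: pos_add)
      ultimately show "p \<in> ?h ` Sigma {..<k} ?I" by blast
    qed
  qed
  then have "width_inv n k \<sigma> = card (Sigma {..<k} ?I)"
    unfolding width_inv_def by (rule bij_betw_same_card[symmetric])
  also have "\<dots> = (\<Sum>c<k. card (?I c))"
    using fin by (simp add: card_SigmaI)
  also have "\<dots> = (\<Sum>c<k. list_inv (map (\<lambda>j. \<sigma> (pos c j)) [0..<class_size c]))"
    unfolding list_inv_def by (intro sum.cong refl arg_cong[where f = card]) auto
  finally show ?thesis
    by (simp add: classes_def comp_def sum_list_distinct_conv_sum_set atLeast0LessThan)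
qed

text \<open>Common core of both identities: any statistic \<open>st\<close> is allowed whose
  generating function over the words on a finite set depends only on the size of that set.\<close>

lemma sum_permutes_classes:
  fixes st :: "nat list \<Rightarrow> nat" and E :: "nat \<Rightarrow> rat poly"
  assumes "\<And>S. finite S \<Longrightarrow> (\<Sum>xs\<in>permutations_of_set S. monom 1 (st xs)) = E (card S)"
  shows "(\<Sum>\<sigma> | \<sigma> permutes {1..n}. monom 1 (\<Sum>b\<leftarrow>classes. st (map \<sigma> b))) =
    smult (multinomial n (replicate r (d + 1) @ replicate (k - r) d)) (E (d + 1) ^ r * E d ^ (k - r))"
proof -
  let ?ms = "replicate r (d + 1) @ replicate (k - r) d"
  have monom_sum_list: "monom 1 (\<Sum>b\<leftarrow>bs. st b) = (\<Prod>b\<leftarrow>bs. monom (1 :: rat) (st b))" for bs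
    by (induction bs) (simp_all, metis mult_1 mult_monom)
  \<comment> \<open>Cutting the word read along all classes at the prescribed lengths gives back the
    subwords of the single classes.\<close>
  have "chunks ?ms (map \<sigma> (concat classes)) = map (map \<sigma>) classes" for \<sigma> :: "nat \<Rightarrow> nat"
    using chunks_concat[of "map (map \<sigma>) classes"] length_classes class_sizes
    by (simp add: map_concat comp_def)
  then have "(\<Sum>\<sigma> | \<sigma> permutes {1..n}. monom 1 (\<Sum>b\<leftarrow>classes. st (map \<sigma> b))) =
      (\<Sum>\<sigma> | \<sigma> permutes {1..n}. \<Prod>b\<leftarrow>chunks ?ms (map \<sigma> (concat classes)). monom (1 :: rat) (st b))"
    using monom_sum_list[of "map (map _) classes"] by (simp add: comp_def)
  also have "\<dots> = (\<Sum>xs\<in>permutations_of_set {1..n}. \<Prod>b\<leftarrow>chunks ?ms xs. monom 1 (st b))"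
    by (rule sum.reindex_bij_betw[OF bij_betw_permutes_permutations_of_set
          [OF distinct_concat_classes set_concat_classes]])
  also have "\<dots> = smult (multinomial n ?ms) (\<Prod>m\<leftarrow>?ms. E m)"
    using sum_permutations_of_set_chunks[of "\<lambda>xs. monom 1 (st xs)" E "{1..n}" ?ms] assms
      sum_class_sizes by simp
  finally show ?thesis
    by (simp add: prod_list_replicate)
qed

end

theorem theorem2p3:
  fixes n k d r :: nat and M :: rat
  assumes "1 \<le> k" and "k \<le> n - 1" and "n = d * k + r" and "r < k"
    and "M = multinomial n (replicate r (d + 1) @ replicate (k - r) d)"
  shows "M = fact n / (fact (d + 1) ^ r * fact d ^ (k - r)) \<and>
         (\<Sum>\<sigma> | \<sigma> permutes {1..n}. monom 1 (width_des n k \<sigma>)) =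
           smult M (eulerian_poly (d + 1) ^ r * eulerian_poly d ^ (k - r)) \<and>
         (\<Sum>\<sigma> | \<sigma> permutes {1..n}. monom 1 (width_inv n k \<sigma>)) =
           smult M (q_fact (d + 1) ^ r * q_fact d ^ (k - r))"
proof (intro conjI)
  interpret residue_classes n k d r
    using assms by unfold_locales
  show "M = fact n / (fact (d + 1) ^ r * fact d ^ (k - r))"
    using assms(5) by (simp only: multinomial_replicate)
  show "(\<Sum>\<sigma> | \<sigma> permutes {1..n}. monom 1 (width_des n k \<sigma>)) =
      smult M (eulerian_poly (d + 1) ^ r * eulerian_poly d ^ (k - r))"
    using sum_permutes_classes[OF sum_monom_list_des] assms(2,5) width_des_eq by simp
  \<comment> \<open>The identity for an arbitrary ring element \<open>q\<close> is specialised to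
    the indeterminate \<open>monom 1 1\<close>, whose powers are the monomials in
    \<open>q_fact\<close>.\<close>
  have "(\<Sum>xs\<in>permutations_of_set S. monom 1 (list_inv xs)) = q_fact (card S)"
    if "finite S" for S :: "nat set"
    using sum_power_list_inv[OF that, of "monom 1 1 :: rat poly"] by (simp add: q_fact_def monom_power)
  from sum_permutes_classes[OF this]
  show "(\<Sum>\<sigma> | \<sigma> permutes {1..n}. monom 1 (width_inv n k \<sigma>)) =
      smult M (q_fact (d + 1) ^ r * q_fact d ^ (k - r))"
    using assms(5) width_inv_eq by simp
qed

end
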